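(* Let $\mathbb{E}$ be a Euclidean space and let $f:\mathbb{E}\to\mathbb{R}\cup\{+\infty\}$ be proper, convex and lower semicontinuous. Then $\mathrm{epi}\,f=\overline{\mathrm{conv}}(\mathrm{gph}\,f)$ if and only if $f$ does not have an affine majorant on its domain.
   Context: A Euclidean space is a finite-dimensional real inner product space. $\mathrm{dom}\,f:=\{x : f(x)<+\infty\}$; $f$ is proper if $\mathrm{dom}\,f\ne\emptyset$ (and $f$ never takes the value $-\infty$). $\mathrm{epi}\,f:=\{(x,\alpha)\in\mathbb{E}\times\mathbb{R} : f(x)\le\alpha\}$; $\mathrm{gph}\,f:=\{(x,f(x)) : x\in\mathrm{dom}\,f\}$; $\overline{\mathrm{conv}}$ is the closed convex hull. An affine majorant of $f$ on its domain is an affine function $g:\mathbb{E}\to\mathbb{R}$, $g(x)=\langle a,x\rangle+\beta$, with $f(x)\le g(x)$ for all $x\in\mathrm{dom}\,f$. *)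

theory Defs
  imports "HOL-Analysis.Analysis"
begin

(* Functions into \<real> \<union> {+\<infinity>} are ereal-valued functions that avoid -\<infinity>. *)

definition edom :: "('a \<Rightarrow> ereal) \<Rightarrow> 'a set" where
  "edom f = {x. f x < \<infinity>}"

definition epi :: "('a \<Rightarrow> ereal) \<Rightarrow> ('a \<times> real) set" where
  "epi f = {(x, \<alpha>). f x \<le> ereal \<alpha>}"

definition gph :: "('a \<Rightarrow> ereal) \<Rightarrow> ('a \<times> real) set" where
  "gph f = {(x, \<alpha>). x \<in> edom f \<and> f x = ereal \<alpha>}"

definition proper_fun :: "('a \<Rightarrow> ereal) \<Rightarrow> bool" where
  "proper_fun f \<longleftrightarrow> edom f \<noteq> {} \<and> (\<forall>x. f x \<noteq> -\<infinity>)"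

(* The weights are strictly between 0 and 1, so no product 0 * \<infinity> occurs; for f avoiding -\<infinity>,
   no sum of opposite infinities occurs either. *)
definition convex_fun :: "('a::real_vector \<Rightarrow> ereal) \<Rightarrow> bool" where
  "convex_fun f \<longleftrightarrow>
     (\<forall>x y. \<forall>t\<in>{0<..<1::real}.
        f ((1 - t) *\<^sub>R x + t *\<^sub>R y) \<le> ereal (1 - t) * f x + ereal t * f y)"

definition lsc_fun :: "('a::topological_space \<Rightarrow> ereal) \<Rightarrow> bool" where
  "lsc_fun f \<longleftrightarrow> (\<forall>x. f x \<le> Liminf (nhds x) f)"

definition closed_convex_hull :: "'a::real_normed_vector set \<Rightarrow> 'a set" where
  "closed_convex_hull S = closure (convex hull S)"

definition has_affine_majorant :: "('a::real_inner \<Rightarrow> ereal) \<Rightarrow> bool" where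
  "has_affine_majorant f \<longleftrightarrow> (\<exists>a \<beta>. \<forall>x\<in>edom f. f x \<le> ereal (inner a x + \<beta>))"

(* A Euclidean space is any finite-dimensional real inner product space. Unlike the class
   euclidean_space, this includes the zero-dimensional space. *)
definition is_euclidean :: "'a::real_inner itself \<Rightarrow> bool" where
  "is_euclidean _ \<longleftrightarrow> (\<exists>B :: 'a set. finite B \<and> span B = UNIV)"

end

theory Submission
  imports Defs
begin

text \<open>
  The closed convex hull \<open>C\<close> of the graph always lies in the epigraph, because the epigraph
  of a convex lower semicontinuous function is convex and closed. The two sets are thus compared
  through closed half-spaces of \<open>E \<times> \<real>\<close>.

  If \<open>f\<close> has an affine majorant, then the region below the majorant is a closed half-space
  containing the graph, hence \<open>C\<close>; the epigraph is unbounded above over every point of the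
  domain, so it is strictly larger than \<open>C\<close>. Conversely, let \<open>(x, \<alpha>)\<close> be a point of the epigraph
  outside \<open>C\<close>, and separate it strictly from \<open>C\<close> by a hyperplane. The graph point \<open>(x, f x)\<close> lies
  in \<open>C\<close> and vertically below \<open>(x, \<alpha>)\<close>, so the normal of the hyperplane has a nonzero vertical
  component and \<open>C\<close> lies on its lower side. The hyperplane is therefore the graph of an affine
  function on \<open>E\<close>, and since the graph of \<open>f\<close> lies below it, this function is a majorant.

  The strict separation is where finite dimension enters: it needs a point of \<open>C\<close> closest to a
  given point. The space is given by a finite spanning set rather than by a type class, so the
  compactness of its bounded closed sets is derived from coordinates in an orthogonal basis.
\<close>

section \<open>Compactness and separation in finite-dimensional inner product spaces\<close>

lemma compact_if_closed_subset:
  fixes S :: "'a::t2_space set"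
  assumes "closed S" "S \<subseteq> K" "compact K"
  shows "compact S"
  using closed_Int_compact[OF assms(1,3)] assms(2) by (simp add: inf.absorb1)

lemma compact_finite_sums:
  fixes K :: "'i \<Rightarrow> 'a::real_normed_vector set"
  assumes "finite C" and "\<And>c. c \<in> C \<Longrightarrow> compact (K c)"
  shows "compact {\<Sum>c\<in>C. v c | v. \<forall>c\<in>C. v c \<in> K c}"
  using assms
proof (induction C rule: finite_induct)
  case empty
  then show ?case by simp
next
  case (insert d C)
  have "{\<Sum>c\<in>insert d C. v c | v. \<forall>c\<in>insert d C. v c \<in> K c}
      = {x + y | x y. x \<in> K d \<and> y \<in> {\<Sum>c\<in>C. v c | v. \<forall>c\<in>C. v c \<in> K c}}" (is "?L = ?R")
  proof
    show "?L \<subseteq> ?R"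
      using insert.hyps by fastforce
  next
    show "?R \<subseteq> ?L"
    proof
      fix z assume "z \<in> ?R"
      then obtain x v where z: "z = x + (\<Sum>c\<in>C. v c)" "x \<in> K d" "\<forall>c\<in>C. v c \<in> K c"
        by blast
      have "(\<Sum>c\<in>C. (v(d := x)) c) = (\<Sum>c\<in>C. v c)"
        using insert.hyps by (intro sum.cong) auto
      then have "z = (\<Sum>c\<in>insert d C. (v(d := x)) c)"
        using z insert.hyps by simp
      moreover have "\<forall>c\<in>insert d C. (v(d := x)) c \<in> K c"
        using z by auto
      ultimately show "z \<in> ?L" by blast
    qed
  qed
  moreover have "compact ?R"
    by (intro compact_sums insert.IH insert.prems) auto
  ultimately show ?case by simp
qed

text \<open>By the Pythagorean theorem the components of a vector of norm at most \<open>r\<close> along an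
  orthogonal basis have norm at most \<open>r\<close>, so the ball lies in a finite sum of compact segments.\<close>

lemma is_euclidean_compact_cball:
  assumes "is_euclidean TYPE('a::real_inner)"
  shows "compact (cball (0::'a) r)"
proof -
  obtain B :: "'a set" where "finite B" "span B = UNIV"
    using assms unfolding is_euclidean_def by blast
  then obtain C :: "'a set" where C: "finite C" "span C = UNIV" "pairwise orthogonal C"
    using basis_orthogonal by metis
  \<comment> \<open>If \<open>0 \<in> C\<close>, then \<open>r / norm 0 = 0\<close> makes the segment along \<open>0\<close> the singleton \<open>{0}\<close>, as it
    should be.\<close>
  define K where "K c = (\<lambda>t. t *\<^sub>R c) ` {- (r / norm c) .. r / norm c}" for c :: 'a
  have compact_K: "compact (K c)" for c
    unfolding K_def by (intro compact_continuous_image continuous_intros compact_Icc)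
  have "cball 0 r \<subseteq> {\<Sum>c\<in>C. v c | v. \<forall>c\<in>C. v c \<in> K c}"
  proof
    fix x :: 'a assume x: "x \<in> cball 0 r"
    then have "0 \<le> r"
      using order_trans[OF norm_ge_zero[of x]] by simp
    have "x \<in> range (\<lambda>u. \<Sum>c\<in>C. u c *\<^sub>R c)"
      using span_finite[OF C(1)] C(2) by simp
    then obtain u where u: "x = (\<Sum>c\<in>C. u c *\<^sub>R c)"
      by blast
    have sq: "(norm x)\<^sup>2 = (\<Sum>c\<in>C. (norm (u c *\<^sub>R c))\<^sup>2)"
      unfolding u using C
      by (intro norm_sum_Pythagorean) (auto simp: pairwise_def orthogonal_def)
    have "u c *\<^sub>R c \<in> K c" if "c \<in> C" for c
    proof (cases "c = 0")
      case True
      then show ?thesis by (simp add: K_def)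
    next
      case False
      have "(norm (u c *\<^sub>R c))\<^sup>2 \<le> (norm x)\<^sup>2"
        unfolding sq using C that by (intro member_le_sum) auto
      also have "\<dots> \<le> r\<^sup>2"
        using x by (intro power_mono) auto
      finally have "\<bar>u c\<bar> * norm c \<le> r"
        using \<open>0 \<le> r\<close> by (simp add: power2_le_iff_abs_le abs_mult)
      then have "\<bar>u c\<bar> \<le> r / norm c"
        using False by (simp add: pos_le_divide_eq)
      then show ?thesis unfolding K_def by (intro imageI) auto
    qed
    then show "x \<in> {\<Sum>c\<in>C. v c | v. \<forall>c\<in>C. v c \<in> K c}"
      using u by blast
  qed
  moreover have "compact {\<Sum>c\<in>C. v c | v. \<forall>c\<in>C. v c \<in> K c}"
    using C(1) compact_K by (intro compact_finite_sums)
  ultimately show ?thesis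
    by (rule compact_if_closed_subset[OF closed_cball])
qed

lemma is_euclidean_compact_cball_prod:
  fixes p :: "'a::real_inner \<times> real"
  assumes "is_euclidean TYPE('a)"
  shows "compact (cball p r)"
proof -
  have "cball p r \<subseteq> cball 0 (norm p + r) \<times> cball 0 (norm p + r)"
  proof
    fix q assume "q \<in> cball p r"
    then have "norm q \<le> norm p + r"
      using norm_triangle_ineq4[of p "p - q"] by (simp add: dist_norm)
    moreover have "norm (fst q) \<le> norm q" "norm (snd q) \<le> norm q"
      by (metis norm_fst_le prod.collapse) (metis norm_snd_le prod.collapse)
    ultimately show "q \<in> cball 0 (norm p + r) \<times> cball 0 (norm p + r)"
      by (simp add: mem_Times_iff)
  qed
  moreover have "compact (cball (0::'a) (norm p + r) \<times> cball (0::real) (norm p + r))"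
    by (intro compact_Times is_euclidean_compact_cball assms compact_cball)
  ultimately show ?thesis
    by (rule compact_if_closed_subset[OF closed_cball])
qed

text \<open>If \<open>y\<close> is a point of \<open>S\<close> closest to \<open>z\<close>, then the hyperplane through the midpoint of \<open>y\<close> and
  \<open>z\<close> with normal \<open>y - z\<close> separates; compact balls guarantee that \<open>y\<close> exists.\<close>

lemma strict_separation_closed_point:
  fixes S :: "'a::real_inner set"
  assumes "convex S" "closed S" "z \<notin> S" and compact: "\<And>r. compact (cball z r)"
  obtains a b where "inner a z < b" "\<And>x. x \<in> S \<Longrightarrow> b < inner a x"
proof (cases "S = {}")
  case True
  show ?thesis
    by (rule that[of 0 1]) (use True in auto)
next
  case False
  then obtain s where s: "s \<in> S" by blast
  have "compact (S \<inter> cball z (dist z s))"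
    using \<open>closed S\<close> compact by (rule closed_Int_compact)
  moreover have "S \<inter> cball z (dist z s) \<noteq> {}"
    using s by auto
  moreover have "continuous_on (S \<inter> cball z (dist z s)) (dist z)"
    by (intro continuous_intros)
  ultimately obtain y where y: "y \<in> S \<inter> cball z (dist z s)"
    and min: "\<And>x. x \<in> S \<inter> cball z (dist z s) \<Longrightarrow> dist z y \<le> dist z x"
    using continuous_attains_inf[of "S \<inter> cball z (dist z s)" "dist z"] by blast
  have closest: "\<forall>x\<in>S. dist z y \<le> dist z x"
    using y min by force
  define a where "a = y - z"
  have "a \<noteq> 0" using y \<open>z \<notin> S\<close> by (auto simp: a_def)
  then have "0 < inner a a" by simp
  then have less: "inner a z < inner a y"
    by (simp add: a_def inner_diff_right)
  show ?thesis
  proof (rule that[of a "(inner a y + inner a z) / 2"])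
    show "inner a z < (inner a y + inner a z) / 2"
      using less by simp
    fix x assume "x \<in> S"
    have "inner (z - y) (x - y) \<le> 0"
      by (rule any_closest_point_dot[OF \<open>convex S\<close> \<open>closed S\<close> _ \<open>x \<in> S\<close> closest]) (use y in simp)
    then have "inner a y \<le> inner a x"
      by (simp add: a_def inner_diff_left inner_diff_right)
    then show "(inner a y + inner a z) / 2 < inner a x"
      using less by simp
  qed
qed

section \<open>Epigraphs and graphs\<close>

lemma gph_subset_epi: "gph f \<subseteq> epi f"
  by (auto simp: gph_def epi_def)

lemma convex_epi:
  fixes f :: "'a::real_vector \<Rightarrow> ereal"
  assumes "proper_fun f" "convex_fun f"
  shows "convex (epi f)"
  unfolding convex_alt
proof (intro ballI allI impI)
  fix p q and t :: real
  assume p: "p \<in> epi f" and q: "q \<in> epi f" and t: "0 \<le> t \<and> t \<le> 1"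
  obtain x \<alpha> y \<beta> where pq: "p = (x, \<alpha>)" "q = (y, \<beta>)"
    by (cases p, cases q)
  have le: "f x \<le> ereal \<alpha>" "f y \<le> ereal \<beta>"
    using p q by (auto simp: pq epi_def)
  have fin: "f x \<noteq> -\<infinity>" "f y \<noteq> -\<infinity>"
    using assms(1) by (auto simp: proper_fun_def)
  obtain a b where ab: "f x = ereal a" "f y = ereal b"
    using le fin by (cases "f x"; cases "f y") auto
  show "(1 - t) *\<^sub>R p + t *\<^sub>R q \<in> epi f"
  proof (cases "t = 0 \<or> t = 1")
    case True
    then show ?thesis using p q by auto
  next
    case False
    with t have "t \<in> {0<..<1}" by auto
    then have "f ((1 - t) *\<^sub>R x + t *\<^sub>R y) \<le> ereal (1 - t) * f x + ereal t * f y"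
      using assms(2) unfolding convex_fun_def by blast
    also have "\<dots> \<le> ereal ((1 - t) * \<alpha> + t * \<beta>)"
      using le t by (simp add: ab add_mono mult_left_mono)
    finally show ?thesis by (simp add: pq epi_def)
  qed
qed

lemma closed_epi:
  fixes f :: "'a::real_normed_vector \<Rightarrow> ereal"
  assumes "lsc_fun f"
  shows "closed (epi f)"
  unfolding closed_sequential_limits
proof (intro allI impI, elim conjE)
  fix X and l :: "'a \<times> real"
  assume X: "\<forall>n. X n \<in> epi f" and lim: "X \<longlonglongrightarrow> l"
  obtain x \<alpha> where l: "l = (x, \<alpha>)" by (cases l)
  have lim1: "(\<lambda>n. fst (X n)) \<longlonglongrightarrow> x" and lim2: "(\<lambda>n. snd (X n)) \<longlonglongrightarrow> \<alpha>"
    using tendsto_fst[OF lim] tendsto_snd[OF lim] by (simp_all add: l)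
  have "f x \<le> ereal \<alpha>"
  proof (rule ccontr)
    assume "\<not> f x \<le> ereal \<alpha>"
    then obtain y where y: "\<alpha> < y" "ereal y < f x"
      using ereal_dense2[of "ereal \<alpha>" "f x"] by (auto simp: not_le)
    have "ereal y < Liminf (nhds x) f"
      using y(2) assms unfolding lsc_fun_def by (meson less_le_trans)
    then have "\<forall>\<^sub>F z in nhds x. ereal y < f z"
      by (rule less_LiminfD)
    then have "\<forall>\<^sub>F n in sequentially. ereal y < f (fst (X n))"
      using lim1 unfolding filterlim_iff by blast
    moreover have "\<forall>\<^sub>F n in sequentially. snd (X n) < y"
      using lim2 y(1) by (rule order_tendstoD)
    ultimately have "\<forall>\<^sub>F n in sequentially. False"
    proof eventually_elim
      case (elim n)
      moreover have "f (fst (X n)) \<le> ereal (snd (X n))"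
        using X[rule_format, of n] by (auto simp: epi_def case_prod_beta)
      ultimately show ?case
        by (metis ereal_less_eq(3) less_le_not_le order_trans)
    qed
    then show False by simp
  qed
  then show "l \<in> epi f" by (simp add: l epi_def)
qed

lemma closed_convex_hull_gph_subset_epi:
  fixes f :: "'a::real_normed_vector \<Rightarrow> ereal"
  assumes "proper_fun f" "convex_fun f" "lsc_fun f"
  shows "closed_convex_hull (gph f) \<subseteq> epi f"
  unfolding closed_convex_hull_def
  by (intro closure_minimal hull_minimal gph_subset_epi convex_epi closed_epi assms)

section \<open>Affine majorants as half-spaces containing the graph\<close>

lemma affine_majorant_imp_epi_neq:
  fixes f :: "'a::real_inner \<Rightarrow> ereal"
  assumes "proper_fun f" "has_affine_majorant f"
  shows "epi f \<noteq> closed_convex_hull (gph f)"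
proof
  assume eq: "epi f = closed_convex_hull (gph f)"
  obtain a \<beta> where maj: "\<And>x. x \<in> edom f \<Longrightarrow> f x \<le> ereal (inner a x + \<beta>)"
    using assms(2) unfolding has_affine_majorant_def by blast
  define H where "H = {p. inner (- a, 1::real) p \<le> \<beta>}"
  have "gph f \<subseteq> H"
    using maj by (force simp: gph_def H_def)
  then have "epi f \<subseteq> H"
    unfolding eq closed_convex_hull_def H_def
    by (intro closure_minimal hull_minimal convex_halfspace_le closed_halfspace_le)
  moreover obtain x where x: "x \<in> edom f"
    using assms(1) unfolding proper_fun_def by blast
  have "f x \<le> ereal (inner a x + \<beta> + 1)"
    by (rule order_trans[OF maj[OF x]]) simp
  then have "(x, inner a x + \<beta> + 1) \<in> epi f"
    by (simp add: epi_def)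
  ultimately have "(x, inner a x + \<beta> + 1) \<in> H" by blast
  then show False by (simp add: H_def)
qed

lemma epi_not_subset_imp_affine_majorant:
  fixes f :: "'a::real_inner \<Rightarrow> ereal"
  assumes "is_euclidean TYPE('a)" "proper_fun f"
    and "\<not> epi f \<subseteq> closed_convex_hull (gph f)"
  shows "has_affine_majorant f"
proof -
  obtain x \<alpha> where epi: "f x \<le> ereal \<alpha>" and notin: "(x, \<alpha>) \<notin> closed_convex_hull (gph f)"
    using assms(3) by (auto simp: epi_def)
  have gph_sub: "gph f \<subseteq> closed_convex_hull (gph f)"
    unfolding closed_convex_hull_def by (meson closure_subset hull_subset order_trans)
  have "convex (closed_convex_hull (gph f))" "closed (closed_convex_hull (gph f))"
    by (simp_all add: closed_convex_hull_def convex_closure)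
  then obtain n c where sep: "inner n (x, \<alpha>) < c"
    "\<And>p. p \<in> closed_convex_hull (gph f) \<Longrightarrow> c < inner n p"
    using notin is_euclidean_compact_cball_prod[OF assms(1)]
    by (rule strict_separation_closed_point) blast
  obtain a b where n: "n = (a, b)" by (cases n)
  have above: "c < inner a y + b * r" if "f y = ereal r" for y r
  proof -
    have "(y, r) \<in> gph f" using that by (simp add: gph_def edom_def)
    then show ?thesis using sep(2) gph_sub by (force simp: n)
  qed
  have ninf: "f y \<noteq> -\<infinity>" for y
    using assms(2) by (simp add: proper_fun_def)
  obtain r where r: "f x = ereal r" "r \<le> \<alpha>"
    using epi ninf[of x] by (cases "f x") auto
  have "b * \<alpha> < b * r"
    using above[OF r(1)] sep(1) by (simp add: n)
  then have "b < 0"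
    using r(2) by (meson leI mult_left_mono not_less)
  \<comment> \<open>Solving \<open>c < inner a y + b * r\<close> for \<open>r\<close> reverses the inequality.\<close>
  have "f y \<le> ereal (inner (- (a /\<^sub>R b)) y + c / b)" if y: "y \<in> edom f" for y
  proof -
    obtain s where s: "f y = ereal s"
      using y ninf[of y] unfolding edom_def by (cases "f y") auto
    have "b * s > c - inner a y" using above[OF s] by simp
    then have "s < (c - inner a y) / b"
      using \<open>b < 0\<close> by (simp add: neg_less_divide_eq mult.commute)
    then show ?thesis by (simp add: s diff_divide_distrib divide_inverse algebra_simps)
  qed
  then show ?thesis unfolding has_affine_majorant_def by blast
qed

theorem theorem38:
  fixes f :: "'a::real_inner \<Rightarrow> ereal"
  assumes "is_euclidean TYPE('a)"
    and "proper_fun f"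
    and "convex_fun f"
    and "lsc_fun f"
  shows "epi f = closed_convex_hull (gph f) \<longleftrightarrow> \<not> has_affine_majorant f"
  using affine_majorant_imp_epi_neq[OF assms(2)]
    epi_not_subset_imp_affine_majorant[OF assms(1,2)]
    closed_convex_hull_gph_subset_epi[OF assms(2-4)]
  by blast

end
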